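(* Let $f:(0,\infty)\to\mathbb{R}$ be convex with $f(1)=0$. The $f$-divergence $D_f[p_\theta:p_{\theta'}]$ between two Poincaré distributions, $\theta,\theta'\in\mathrm{Sym}^+(2,\mathbb{R})$, is a function of the triplet $\left(|\theta|,|\theta'|,\mathrm{tr}(\theta'\theta^{-1})\right)$ (that is, there is a function $\Phi_f$ such that $D_f[p_\theta:p_{\theta'}]=\Phi_f\left(|\theta|,|\theta'|,\mathrm{tr}(\theta'\theta^{-1})\right)$ for all $\theta,\theta'\in\mathrm{Sym}^+(2,\mathbb{R})$), and it is invariant with respect to the $\mathrm{SL}(2,\mathbb{R})$-action, i.e. $D_f[p_{g.\theta}:p_{g.\theta'}]=D_f[p_\theta:p_{\theta'}]$ for all $g\in\mathrm{SL}(2,\mathbb{R})$, where $g.\theta=g^{-\top}\theta g^{-1}$.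
   Context: $\mathbb{H}=\{(x,y)\in\mathbb{R}^2: y>0\}$. $\mathrm{Sym}^+(2,\mathbb{R})$ is the set of real symmetric positive-definite $2\times2$ matrices; $|\theta|$ denotes the determinant of $\theta$; $A^{-\top}=(A^{-1})^\top$. For $\theta=\begin{bmatrix} a & b \\ b & c \end{bmatrix}\in\mathrm{Sym}^+(2,\mathbb{R})$, the Poincaré distribution $p_\theta$ is the probability distribution on $\mathbb{H}$ with density (with respect to $dx\,dy$) $$p_\theta(x,y)=\frac{\sqrt{|\theta|}\,e^{2\sqrt{|\theta|}}}{\pi}\exp\left(-\frac{a(x^2+y^2)+2bx+c}{y}\right)\frac1{y^2}.$$ The $f$-divergence between densities $p,q$ on $\mathbb{H}$ is $D_f[p:q]=\int_{\mathbb{H}}p\,f(q/p)\,dx\,dy\in[0,+\infty]$. *)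

theory Defs
  imports "HOL-Analysis.Analysis"
begin

definition upper_half_plane :: "(real \<times> real) set" where
  "upper_half_plane = {(x, y). y > 0}"

definition Sym_pos :: "(real^2^2) set" where
  "Sym_pos = {\<theta>. transpose \<theta> = \<theta> \<and> (\<forall>v. v \<noteq> 0 \<longrightarrow> v \<bullet> (\<theta> *v v) > 0)}"

definition SL2 :: "(real^2^2) set" where
  "SL2 = {g. det g = 1}"

definition SL2_action :: "real^2^2 \<Rightarrow> real^2^2 \<Rightarrow> real^2^2" where
  "SL2_action g \<theta> = transpose (matrix_inv g) ** \<theta> ** matrix_inv g"

(* Only meaningful on the upper half-plane; values elsewhere are never used. *)
definition poincare_density :: "real^2^2 \<Rightarrow> real \<times> real \<Rightarrow> real" where
  "poincare_density \<theta> = (\<lambda>(x, y).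
     sqrt (det \<theta>) * exp (2 * sqrt (det \<theta>)) / pi *
     exp (- ((\<theta>$1$1 * (x\<^sup>2 + y\<^sup>2) + 2 * \<theta>$1$2 * x + \<theta>$2$2) / y)) * (1 / y\<^sup>2))"

(* Extended-real Lebesgue integral: integral of the positive part minus integral of the
   negative part. It is the usual integral as soon as one of the two parts is finite; if
   both are infinite, the ereal convention \<infinity> - \<infinity> = \<infinity> applies. *)
definition ext_integral :: "'a measure \<Rightarrow> ('a \<Rightarrow> real) \<Rightarrow> ereal" where
  "ext_integral M h =
     enn2ereal (\<integral>\<^sup>+ z. ennreal (h z) \<partial>M) - enn2ereal (\<integral>\<^sup>+ z. ennreal (- h z) \<partial>M)"

(* For convex f with f 1 = 0 there is s with f u \<ge> s * (u - 1) for all u > 0, so for positive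
   probability densities p, q the integrand is bounded below by the integrable function
   s * (q - p). Its negative part therefore has finite integral: the value is never an
   \<infinity> - \<infinity> artefact, and it lies in [0, \<infinity>]. A Bochner integral would instead return 0
   for a divergent integral. *)
definition f_divergence ::
    "(real \<Rightarrow> real) \<Rightarrow> (real \<times> real \<Rightarrow> real) \<Rightarrow> (real \<times> real \<Rightarrow> real) \<Rightarrow> ereal" where
  "f_divergence f p q =
     ext_integral (restrict_space lborel upper_half_plane) (\<lambda>z. p z * f (q z / p z))"

end

theory Submission
  imports Defs "HOL-Library.Quadratic_Discriminant"
begin

text \<open>Both densities, hence the integrand of the divergence, are functions of the values of two
  binary quadratic forms divided by \<open>y\<close>, integrated against the hyperbolic measure. That integral
  does not change when both forms are moved by a translation, a scaling or the inversion of the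
  half-plane; these moves take a pair of forms to the scalar form \<open>s I\<close> and a diagonal form. The
  determinants and the trace determine \<open>s\<close> and the diagonal entries up to order, and the inversion
  exchanges the entries. Invariance under the whole special linear group follows, because the
  action preserves the triplet.\<close>

section \<open>Logarithmic coordinates on the half-plane\<close>

text \<open>The substitution \<open>y = exp t\<close> is made on the compact intervals from
  \<open>exp (- n)\<close> to \<open>exp n\<close>, and monotone convergence in \<open>n\<close>
  reaches the whole half-line. As an identity of measures it serves every nonnegative measurable
  integrand.\<close>

lemma density_positive_reals_eq_distr_exp:
  "density lborel (indicator {0::real<..}) = distr (density lborel (\<lambda>t. ennreal (exp t))) borel exp"
proof (rule measure_eqI)
  fix A :: "real set"
  assume "A \<in> sets (density lborel (indicator {0<..}))"
  then have A [measurable]: "A \<in> sets borel" by simp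
  define F :: "nat \<Rightarrow> real \<Rightarrow> ennreal"
    where "F n y = ennreal (indicator A y * indicator {exp (- real n)..exp (real n)} y)" for n y
  define G :: "nat \<Rightarrow> real \<Rightarrow> ennreal"
    where "G n t = ennreal (indicator A (exp t) * exp t * indicator {- real n..real n} t)" for n t
  have FG: "integral\<^sup>N lborel (F n) = integral\<^sup>N lborel (G n)" for n
    unfolding F_def G_def
    by (rule nn_integral_substitution)
       (auto intro!: derivative_eq_intros continuous_intros simp: set_borel_measurable_def)
  have supF: "(SUP n. F n y) = indicator A y * indicator {0<..} y" for y
  proof (cases "0 < y")
    case True
    obtain n :: nat where n: "\<bar>ln y\<bar> \<le> real n" using real_arch_simple by blast
    have "exp (- real n) \<le> exp (ln y)" "exp (ln y) \<le> exp (real n)"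
      using n unfolding exp_le_cancel_iff by linarith+
    then have "F n y = indicator A y * indicator {0<..} y"
      using True by (simp add: F_def indicator_def)
    moreover have "F m y \<le> indicator A y * indicator {0<..} y" for m
      using True by (simp add: F_def indicator_def)
    ultimately show ?thesis by (metis SUP_least SUP_upper UNIV_I antisym)
  next
    case False
    then have "F n y = 0" for n
      using less_le_trans[OF exp_gt_zero, of "- real n" y] by (auto simp: F_def indicator_def)
    then show ?thesis using False by simp
  qed
  have supG: "(SUP n. G n t) = ennreal (exp t) * indicator A (exp t)" for t
  proof -
    obtain n :: nat where n: "\<bar>t\<bar> \<le> real n" using real_arch_simple by blast
    then have "G n t = ennreal (exp t) * indicator A (exp t)"
      by (auto simp: G_def indicator_def)
    moreover have "G m t \<le> ennreal (exp t) * indicator A (exp t)" for m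
      by (simp add: G_def indicator_def)
    ultimately show ?thesis by (metis SUP_least SUP_upper UNIV_I antisym)
  qed
  have incF: "incseq F"
    unfolding F_def
    by (intro incseq_SucI le_funI ennreal_leI mult_left_mono)
       (auto simp: indicator_def, (smt (verit) exp_le_cancel_iff)+)
  have incG: "incseq G"
    unfolding G_def
    by (intro incseq_SucI le_funI ennreal_leI mult_left_mono)
       (auto simp: indicator_def)
  have [measurable]: "F n \<in> borel_measurable borel" "G n \<in> borel_measurable borel" for n
    unfolding F_def G_def by measurable
  have "emeasure (density lborel (indicator {0<..})) A = (\<integral>\<^sup>+y. (SUP n. F n y) \<partial>lborel)"
    by (subst emeasure_density) (simp_all add: supF mult.commute)
  also have "\<dots> = (\<integral>\<^sup>+t. (SUP n. G n t) \<partial>lborel)"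
    using incF incG by (simp add: nn_integral_monotone_convergence_SUP FG)
  also have "\<dots> = emeasure (density lborel (\<lambda>t. ennreal (exp t))) (exp -` A)"
    using measurable_sets[OF borel_measurable_exp A]
    by (subst emeasure_density) (simp_all add: supG indicator_def)
  also have "\<dots> = emeasure (distr (density lborel (\<lambda>t. ennreal (exp t))) borel exp) A"
    by (subst emeasure_distr) simp_all
  finally show "emeasure (density lborel (indicator {0<..})) A =
    emeasure (distr (density lborel (\<lambda>t. ennreal (exp t))) borel exp) A" .
qed simp

lemma nn_integral_positive_reals_exp:
  assumes [measurable]: "G \<in> borel_measurable borel"
  shows "(\<integral>\<^sup>+y. indicator {0::real<..} y * G y \<partial>lborel) = (\<integral>\<^sup>+t. ennreal (exp t) * G (exp t) \<partial>lborel)"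
proof -
  have "(\<integral>\<^sup>+y. indicator {0<..} y * G y \<partial>lborel) = integral\<^sup>N (density lborel (indicator {0<..})) G"
    by (subst nn_integral_density) auto
  also have "\<dots> = (\<integral>\<^sup>+t. ennreal (exp t) * G (exp t) \<partial>lborel)"
    unfolding density_positive_reals_eq_distr_exp
    by (subst nn_integral_distr) (auto simp: nn_integral_density)
  finally show ?thesis .
qed

text \<open>The coordinates are \<open>x = u * exp t\<close> and \<open>y = exp t\<close>. One
  factor \<open>exp t\<close> of the Jacobian comes from \<open>dy\<close>, the other from rescaling
  \<open>x\<close> at fixed \<open>t\<close>.\<close>

lemma nn_integral_upper_half_plane:
  assumes "F \<in> borel_measurable borel"
  shows "integral\<^sup>N (restrict_space lborel upper_half_plane) F =
    (\<integral>\<^sup>+t. \<integral>\<^sup>+u. ennreal ((exp t)\<^sup>2) * F (u * exp t, exp t) \<partial>lborel \<partial>lborel)"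
proof -
  have F [measurable]: "F \<in> borel_measurable (borel \<Otimes>\<^sub>M borel)"
    using assms by (simp add: borel_prod)
  have ind: "indicator upper_half_plane (x, y) = (indicator {0<..} y :: ennreal)" for x y
    by (simp add: upper_half_plane_def indicator_def)
  have H: "upper_half_plane \<in> sets borel"
    unfolding upper_half_plane_def case_prod_beta by (intro borel_open open_Collect_less continuous_intros)
  then have H' [measurable]: "upper_half_plane \<in> sets (borel \<Otimes>\<^sub>M borel)"
    by (subst borel_prod)
  have "integral\<^sup>N (restrict_space lborel upper_half_plane) F =
      (\<integral>\<^sup>+z. F z * indicator upper_half_plane z \<partial>(lborel \<Otimes>\<^sub>M lborel))"
    using H by (simp add: nn_integral_restrict_space lborel_prod)
  also have "\<dots> = (\<integral>\<^sup>+y. \<integral>\<^sup>+x. F (x, y) * indicator upper_half_plane (x, y) \<partial>lborel \<partial>lborel)"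
    by (rule lborel_pair.nn_integral_snd[symmetric]) measurable
  also have "\<dots> = (\<integral>\<^sup>+y. indicator {0<..} y * (\<integral>\<^sup>+x. F (x, y) \<partial>lborel) \<partial>lborel)"
    unfolding ind by (intro nn_integral_cong) (subst nn_integral_multc, simp_all add: mult.commute)
  also have "\<dots> = (\<integral>\<^sup>+t. ennreal (exp t) * (\<integral>\<^sup>+x. F (x, exp t) \<partial>lborel) \<partial>lborel)"
    by (rule nn_integral_positive_reals_exp) measurable
  also have "\<dots> = (\<integral>\<^sup>+t. \<integral>\<^sup>+u. ennreal ((exp t)\<^sup>2) * F (u * exp t, exp t) \<partial>lborel \<partial>lborel)"
  proof (rule nn_integral_cong)
    fix t :: real
    have "(\<integral>\<^sup>+x. F (x, exp t) \<partial>lborel) =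
        ennreal (exp t) * (\<integral>\<^sup>+u. F (u * exp t, exp t) \<partial>lborel)"
      by (subst nn_integral_real_affine[where c = "exp t" and t = 0]) (auto simp: mult.commute)
    then show "ennreal (exp t) * (\<integral>\<^sup>+x. F (x, exp t) \<partial>lborel) =
        (\<integral>\<^sup>+u. ennreal ((exp t)\<^sup>2) * F (u * exp t, exp t) \<partial>lborel)"
      by (simp add: nn_integral_cmult power2_eq_square ennreal_mult mult.assoc)
  qed
  finally show ?thesis .
qed

section \<open>Hyperbolic integrals of pairs of quadratic forms\<close>

text \<open>The exponent \<open>(a (x\<^sup>2 + y\<^sup>2) + 2 b x + c) / y\<close> at \<open>x = u e\<^sup>t\<close>, \<open>y = e\<^sup>t\<close>.\<close>

definition hyp_form :: "real \<Rightarrow> real \<Rightarrow> real \<Rightarrow> real \<Rightarrow> real \<Rightarrow> real" where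
  "hyp_form a b c u t = a * exp t * (1 + u\<^sup>2) + 2 * b * u + c * exp (- t)"

text \<open>In these coordinates the invariant measure \<open>dx dy / y\<^sup>2\<close> is \<open>du dt\<close>.\<close>

definition hyp_integral ::
    "(real \<times> real \<Rightarrow> ennreal) \<Rightarrow> real \<Rightarrow> real \<Rightarrow> real \<Rightarrow> real \<Rightarrow> real \<Rightarrow> real \<Rightarrow> ennreal" where
  "hyp_integral \<Omega> a b c a' b' c' =
     (\<integral>\<^sup>+t. \<integral>\<^sup>+u. \<Omega> (hyp_form a b c u t, hyp_form a' b' c' u t) \<partial>lborel \<partial>lborel)"

lemma measurable_hyp_form [measurable (raw)]:
  assumes [measurable]: "f \<in> borel_measurable M" "g \<in> borel_measurable M"
  shows "(\<lambda>x. hyp_form a b c (f x) (g x)) \<in> borel_measurable M"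
  unfolding hyp_form_def by measurable

section \<open>Isometry invariance and the normal form of a pair of forms\<close>

context
  fixes \<Omega> :: "real \<times> real \<Rightarrow> ennreal"
  assumes measurable_Omega [measurable]: "\<Omega> \<in> borel_measurable (borel \<Otimes>\<^sub>M borel)"
begin

text \<open>The move \<open>z \<mapsto> z + h\<close> fixes \<open>t\<close> and shifts
  \<open>u\<close> by \<open>h * exp (- t)\<close>, so translation invariance of the inner integral
  suffices.\<close>

lemma hyp_integral_translate:
  "hyp_integral \<Omega> a b c a' b' c' =
   hyp_integral \<Omega> a (a * h + b) (a * h\<^sup>2 + 2 * b * h + c) a' (a' * h + b') (a' * h\<^sup>2 + 2 * b' * h + c')"
  unfolding hyp_integral_def
proof (rule nn_integral_cong)
  fix t :: real
  have *: "hyp_form a b c (h * exp (- t) + u) t =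
      hyp_form a (a * h + b) (a * h\<^sup>2 + 2 * b * h + c) u t" for a b c u
  proof -
    define e where "e = exp t"
    have "e > 0" by (simp add: e_def)
    then show ?thesis
      unfolding hyp_form_def exp_minus e_def[symmetric] by (simp add: field_simps power2_eq_square)
  qed
  show "(\<integral>\<^sup>+u. \<Omega> (hyp_form a b c u t, hyp_form a' b' c' u t) \<partial>lborel) =
    (\<integral>\<^sup>+u. \<Omega> (hyp_form a (a * h + b) (a * h\<^sup>2 + 2 * b * h + c) u t,
             hyp_form a' (a' * h + b') (a' * h\<^sup>2 + 2 * b' * h + c') u t) \<partial>lborel)"
    by (subst nn_integral_real_affine[where c = 1 and t = "h * exp (- t)"]) (simp_all add: *)
qed

text \<open>The dilation \<open>z \<mapsto> r z\<close> fixes \<open>u = x / y\<close> and adds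
  \<open>ln r\<close> to \<open>t\<close>.\<close>

lemma hyp_integral_scale:
  assumes "0 < r"
  shows "hyp_integral \<Omega> a b c a' b' c' = hyp_integral \<Omega> (a * r) b (c / r) (a' * r) b' (c' / r)"
proof -
  have *: "hyp_form a b c u (ln r + t) = hyp_form (a * r) b (c / r) u t" for a b c u t
    using assms by (simp add: hyp_form_def exp_add exp_diff exp_minus field_simps)
  show ?thesis
    unfolding hyp_integral_def
    by (subst nn_integral_real_affine[where c = 1 and t = "ln r"]) (simp_all add: *)
qed

text \<open>The inversion \<open>z \<mapsto> -1/z\<close> is \<open>(u, t) \<mapsto> (-u, - t - ln (1 + u\<^sup>2))\<close>,
  a reflection in each of the variables separately.\<close>

lemma hyp_integral_invert:
  "hyp_integral \<Omega> a b c a' b' c' = hyp_integral \<Omega> c (- b) a c' (- b') a'"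
proof -
  let ?I = "\<lambda>a b c a' b' c' u. \<integral>\<^sup>+t. \<Omega> (hyp_form a b c u t, hyp_form a' b' c' u t) \<partial>lborel"
  \<comment> \<open>The reflection of \<open>t\<close> below depends on \<open>u\<close>, so Fubini
    first makes \<open>t\<close> the inner variable.\<close>
  have swap: "hyp_integral \<Omega> a b c a' b' c' = (\<integral>\<^sup>+u. ?I a b c a' b' c' u \<partial>lborel)" for a b c a' b' c'
    unfolding hyp_integral_def by (intro lborel_pair.Fubini') measurable
  have pos: "0 < 1 + u\<^sup>2" for u :: real by (simp add: add_pos_nonneg)
  have *: "hyp_form a b c (- u) (- ln (1 + u\<^sup>2) - t) = hyp_form c (- b) a u t" for a b c u t
  proof -
    define k where "k = 1 + u\<^sup>2"
    have "k > 0" using pos by (simp add: k_def)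
    then show ?thesis
      unfolding hyp_form_def power2_minus k_def[symmetric]
      by (simp add: exp_add exp_diff exp_minus field_simps)
  qed
  have reflect: "?I a b c a' b' c' (- u) = ?I c (- b) a c' (- b') a' u" for u
    by (subst nn_integral_real_affine[where c = "- 1" and t = "- ln (1 + u\<^sup>2)"]) (simp_all add: *)
  have "hyp_integral \<Omega> a b c a' b' c' = (\<integral>\<^sup>+u. ?I a b c a' b' c' (- u) \<partial>lborel)"
    unfolding swap by (subst nn_integral_real_affine[where c = "- 1" and t = 0]) simp_all
  then show ?thesis by (simp only: reflect swap)
qed

text \<open>The condition \<open>a * b' = a' * b\<close> lets a single translation by
  \<open>- b / a\<close> remove both middle coefficients; a dilation then makes the first form
  scalar. The last two equations hold because these moves preserve the determinants and the mixed
  discriminant \<open>a * c' + a' * c - 2 * b * b'\<close>.\<close>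

lemma hyp_integral_normalize_commuting:
  assumes "0 < a" "0 < a * c - b\<^sup>2" "a * b' = a' * b"
  defines "s \<equiv> sqrt (a * c - b\<^sup>2)"
  obtains \<alpha> \<gamma> where "hyp_integral \<Omega> a b c a' b' c' = hyp_integral \<Omega> s 0 s \<alpha> 0 \<gamma>"
    "\<alpha> * \<gamma> = a' * c' - b'\<^sup>2" "s * (\<alpha> + \<gamma>) = a * c' + a' * c - 2 * b * b'"
proof -
  define h where "h = - b / a"
  have s: "0 < s" "s\<^sup>2 = a * c - b\<^sup>2" using assms by (simp_all add: s_def)
  have b': "b' = a' * b / a" using assms(1,3) by (simp add: field_simps)
  have 1: "a * h + b = 0" "a' * h + b' = 0"
    using assms(1) by (simp_all add: h_def b')
  have 2: "a * h\<^sup>2 + 2 * b * h + c = s\<^sup>2 / a"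
    unfolding s using assms(1) by (simp add: h_def field_simps power2_eq_square)
  let ?q' = "a' * h\<^sup>2 + 2 * b' * h + c'"
  have "hyp_integral \<Omega> a b c a' b' c' = hyp_integral \<Omega> a 0 (s\<^sup>2 / a) a' 0 ?q'"
    by (subst hyp_integral_translate[of _ _ _ _ _ _ h]) (simp only: 1 2)
  \<comment> \<open>The outer coefficients \<open>a\<close> and \<open>s\<^sup>2 / a\<close> have
    product \<open>s\<^sup>2\<close>; scaling by \<open>s / a\<close> makes both equal to
    \<open>s\<close>.\<close>
  also have "\<dots> = hyp_integral \<Omega> (a * (s / a)) 0 (s\<^sup>2 / a / (s / a)) (a' * (s / a)) 0 (?q' / (s / a))"
    using s(1) assms(1) by (intro hyp_integral_scale) simp
  also have "\<dots> = hyp_integral \<Omega> s 0 s (a' * (s / a)) 0 (?q' / (s / a))"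
    using s(1) assms(1) by (simp add: power2_eq_square)
  finally have "hyp_integral \<Omega> a b c a' b' c' = hyp_integral \<Omega> s 0 s (a' * (s / a)) 0 (?q' / (s / a))" .
  moreover have "a' * (s / a) * (?q' / (s / a)) = a' * c' - b'\<^sup>2"
    using s(1) assms(1) by (simp add: h_def b' field_simps power2_eq_square)
  moreover have "s * (a' * (s / a) + ?q' / (s / a)) = a * c' + a' * c - 2 * b * b'"
  proof -
    have "s * (a' * (s / a) + ?q' / (s / a)) = a' * s\<^sup>2 / a + a * ?q'"
      using s(1) assms(1) by (simp add: field_simps power2_eq_square)
    also have "\<dots> = a * c' + a' * c - 2 * b * b'"
      unfolding s using assms(1) by (simp add: h_def b' field_simps power2_eq_square)
    finally show ?thesis .
  qed
  ultimately show thesis by (rule that)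
qed

text \<open>A real root \<open>h\<close> of the quadratic below is an endpoint of the geodesic through the two points
  of the half-plane represented by the forms. Moving it to infinity makes the geodesic vertical,
  and then a translation diagonalizes both forms.\<close>

lemma hyp_integral_normalize:
  assumes "0 < a" "0 < a * c - b\<^sup>2"
  defines "s \<equiv> sqrt (a * c - b\<^sup>2)"
  obtains \<alpha> \<gamma> where "hyp_integral \<Omega> a b c a' b' c' = hyp_integral \<Omega> s 0 s \<alpha> 0 \<gamma>"
    "\<alpha> * \<gamma> = a' * c' - b'\<^sup>2" "s * (\<alpha> + \<gamma>) = a * c' + a' * c - 2 * b * b'"
proof (cases "a * b' = a' * b")
  case True
  show thesis
    using hyp_integral_normalize_commuting[OF assms(1,2) True] that unfolding s_def by metis
next
  case False
  \<comment> \<open>The quadratic in \<open>h\<close> with these coefficients measures by how much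
    the pair fails the condition of \<open>hyp_integral_normalize_commuting\<close> after
    translation by \<open>h\<close> and inversion.\<close>
  let ?\<beta> = "a * b' - a' * b" and ?\<delta> = "a * c' - a' * c" and ?\<epsilon> = "b * c' - b' * c"
  \<comment> \<open>Completing the square: positivity of the first form alone forces a real
    root.\<close>
  have "a\<^sup>2 * discrim ?\<beta> ?\<delta> ?\<epsilon> = (a * ?\<delta> - 2 * b * ?\<beta>)\<^sup>2 + 4 * ?\<beta>\<^sup>2 * (a * c - b\<^sup>2)"
    unfolding discrim_def by (simp add: algebra_simps power2_eq_square)
  also have "\<dots> \<ge> 0" using assms by (intro add_nonneg_nonneg mult_nonneg_nonneg) auto
  finally have "0 \<le> discrim ?\<beta> ?\<delta> ?\<epsilon>"
    using assms(1) by (simp add: zero_le_mult_iff)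
  then obtain h where h: "?\<beta> * h\<^sup>2 + ?\<delta> * h + ?\<epsilon> = 0"
    using discriminant_nonneg_ex[of ?\<beta> ?\<delta> ?\<epsilon>] False by auto
  define b1 c1 where "b1 = a * h + b" and "c1 = a * h\<^sup>2 + 2 * b * h + c"
  define b1' c1' where "b1' = a' * h + b'" and "c1' = a' * h\<^sup>2 + 2 * b' * h + c'"
  note defs = b1_def c1_def b1'_def c1'_def
  \<comment> \<open>Translation and inversion preserve both determinants and the mixed
    discriminant.\<close>
  have inv: "c1 * a - (- b1)\<^sup>2 = a * c - b\<^sup>2" "c1' * a' - (- b1')\<^sup>2 = a' * c' - b'\<^sup>2"
    "c1 * a' + c1' * a - 2 * (- b1) * (- b1') = a * c' + a' * c - 2 * b * b'"
    unfolding defs by (simp_all add: algebra_simps power2_eq_square)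
  have "0 < a * c1"
    using assms(2) inv(1) zero_le_power2[of b1] unfolding power2_minus mult.commute[of c1] by linarith
  then have c1: "0 < c1" using assms(1) by (simp add: zero_less_mult_iff)
  have "c1 * (- b1') - c1' * (- b1) = ?\<beta> * h\<^sup>2 + ?\<delta> * h + ?\<epsilon>"
    unfolding defs by (simp add: algebra_simps power2_eq_square)
  then have comm: "c1 * (- b1') = c1' * (- b1)" using h by simp
  have d: "0 < c1 * a - (- b1)\<^sup>2" using inv(1) assms(2) by simp
  have "hyp_integral \<Omega> a b c a' b' c' = hyp_integral \<Omega> a b1 c1 a' b1' c1'"
    unfolding defs by (rule hyp_integral_translate)
  also have "\<dots> = hyp_integral \<Omega> c1 (- b1) a c1' (- b1') a'"
    by (rule hyp_integral_invert)
  finally have eq: "hyp_integral \<Omega> a b c a' b' c' = hyp_integral \<Omega> c1 (- b1) a c1' (- b1') a'" .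
  show thesis
    using hyp_integral_normalize_commuting[OF c1 d comm, of a'] that eq unfolding s_def inv by metis
qed

text \<open>The third equation compares mixed discriminants, the polarization of the determinant.
  Together the three invariants fix \<open>s\<close> and the sum and product of the diagonal entries
  in the normal form.\<close>

lemma hyp_integral_eqI:
  assumes "0 < a" "0 < a * c - b\<^sup>2" "0 < A"
    and "A * C - B\<^sup>2 = a * c - b\<^sup>2" "A' * C' - B'\<^sup>2 = a' * c' - b'\<^sup>2"
    and "A * C' + A' * C - 2 * B * B' = a * c' + a' * c - 2 * b * b'"
  shows "hyp_integral \<Omega> a b c a' b' c' = hyp_integral \<Omega> A B C A' B' C'"
proof -
  define s where "s = sqrt (a * c - b\<^sup>2)"
  have s: "0 < s" using assms by (simp add: s_def)
  obtain \<alpha> \<gamma> where 1: "hyp_integral \<Omega> a b c a' b' c' = hyp_integral \<Omega> s 0 s \<alpha> 0 \<gamma>"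
    "\<alpha> * \<gamma> = a' * c' - b'\<^sup>2" "s * (\<alpha> + \<gamma>) = a * c' + a' * c - 2 * b * b'"
    using hyp_integral_normalize[OF assms(1,2), of a' b' c'] unfolding s_def by blast
  have d: "0 < A * C - B\<^sup>2" using assms by simp
  obtain \<kappa> \<mu> where 2: "hyp_integral \<Omega> A B C A' B' C' = hyp_integral \<Omega> s 0 s \<kappa> 0 \<mu>"
    "\<kappa> * \<mu> = a' * c' - b'\<^sup>2" "s * (\<kappa> + \<mu>) = a * c' + a' * c - 2 * b * b'"
    using hyp_integral_normalize[OF assms(3) d, of A' B' C'] unfolding s_def assms(4-6) by blast
  have sum: "\<kappa> + \<mu> = \<alpha> + \<gamma>" using 1(3) 2(3) s by (simp flip: 1(3))
  \<comment> \<open>Equal sum and product make \<open>\<kappa>\<close> a root of the monic quadratic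
    with roots \<open>\<alpha>\<close> and \<open>\<gamma>\<close>.\<close>
  have "(\<kappa> - \<alpha>) * (\<kappa> - \<gamma>) = \<kappa> * (\<kappa> + \<mu>) - \<kappa> * (\<alpha> + \<gamma>) + (\<alpha> * \<gamma> - \<kappa> * \<mu>)"
    by (simp add: algebra_simps)
  then have "(\<kappa> - \<alpha>) * (\<kappa> - \<gamma>) = 0" using 1(2) 2(2) sum by simp
  then consider "\<kappa> = \<alpha>" "\<mu> = \<gamma>" | "\<kappa> = \<gamma>" "\<mu> = \<alpha>" using sum by fastforce
  then show ?thesis
  proof cases
    case 1
    then show ?thesis using \<open>hyp_integral \<Omega> a b c a' b' c' = _\<close> 2(1) by simp
  next
    case 2
    then show ?thesis
      using \<open>hyp_integral \<Omega> a b c a' b' c' = _\<close> \<open>hyp_integral \<Omega> A B C A' B' C' = _\<close>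
        hyp_integral_invert[of s 0 s \<alpha> 0 \<gamma>] by simp
  qed
qed

end

section \<open>The divergence of two Poincare distributions\<close>

definition poincare_const :: "real \<Rightarrow> real" where
  "poincare_const d = sqrt d * exp (2 * sqrt d) / pi"

text \<open>The indicator does not change any value, since the ratio of two densities is positive;
  it makes the integrand measurable whatever \<open>f\<close> does outside the positive reals.\<close>

definition divergence_integrand :: "(real \<Rightarrow> real) \<Rightarrow> real \<Rightarrow> real \<Rightarrow> real \<times> real \<Rightarrow> real" where
  "divergence_integrand f d d' = (\<lambda>(v, w). let \<rho> = poincare_const d' / poincare_const d * exp (v - w)
     in poincare_const d * exp (- v) * (indicator {0<..} \<rho> * f \<rho>))"

lemma poincare_const_pos: "0 < d \<Longrightarrow> 0 < poincare_const d"
  by (simp add: poincare_const_def)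

text \<open>A convex function on an open interval is continuous there, hence its extension by zero
  is Borel.\<close>

lemma measurable_convex_on_positive_reals:
  fixes f :: "real \<Rightarrow> real"
  assumes "convex_on {0<..} f"
  shows "(\<lambda>x. indicator {0<..} x * f x) \<in> borel_measurable borel"
  using borel_measurable_continuous_on_indicator[of "{0<..}" f] convex_on_continuous[OF _ assms]
  by simp

lemma measurable_divergence_integrand:
  assumes "convex_on {0<..} f"
  shows "divergence_integrand f d d' \<in> borel_measurable (borel \<Otimes>\<^sub>M borel)"
proof -
  note [measurable] = measurable_compose[OF _ measurable_convex_on_positive_reals[OF assms]]
  show ?thesis
    unfolding divergence_integrand_def Let_def case_prod_beta by measurable
qed

lemma Sym_pos_entries:
  assumes "\<theta> \<in> Sym_pos"
  shows "\<theta>$2$1 = \<theta>$1$2" "0 < \<theta>$1$1" "0 < \<theta>$1$1 * \<theta>$2$2 - (\<theta>$1$2)\<^sup>2"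
    "det \<theta> = \<theta>$1$1 * \<theta>$2$2 - (\<theta>$1$2)\<^sup>2"
proof -
  have "transpose \<theta> $1$2 = \<theta>$1$2" using assms by (simp add: Sym_pos_def)
  then show sym: "\<theta>$2$1 = \<theta>$1$2" by (simp add: transpose_def)
  show "det \<theta> = \<theta>$1$1 * \<theta>$2$2 - (\<theta>$1$2)\<^sup>2"
    by (simp add: det_2 sym power2_eq_square)
  have pos: "0 < \<theta>$1$1 * x\<^sup>2 + 2 * \<theta>$1$2 * x * y + \<theta>$2$2 * y\<^sup>2" if "x \<noteq> 0 \<or> y \<noteq> 0" for x y
  proof -
    let ?v = "vector [x, y] :: real^2"
    have "?v \<noteq> 0" using that by (auto simp: vec_eq_iff forall_2)
    then have "0 < ?v \<bullet> (\<theta> *v ?v)" using assms by (auto simp: Sym_pos_def)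
    then show ?thesis
      by (simp add: inner_vec_def matrix_vector_mult_def sum_2 sym algebra_simps power2_eq_square)
  qed
  from pos[of 1 0] show a: "0 < \<theta>$1$1" by simp
  \<comment> \<open>At the vector \<open>(- b, a)\<close> the form with entries \<open>a\<close>,
    \<open>b\<close>, \<open>c\<close> takes the value
    \<open>a * (a * c - b\<^sup>2)\<close>.\<close>
  have "0 < \<theta>$1$1 * (\<theta>$1$1 * \<theta>$2$2 - (\<theta>$1$2)\<^sup>2)"
    using pos[of "- \<theta>$1$2" "\<theta>$1$1"] a by (simp add: algebra_simps power2_eq_square)
  then show "0 < \<theta>$1$1 * \<theta>$2$2 - (\<theta>$1$2)\<^sup>2" using a by (simp add: zero_less_mult_iff)
qed

text \<open>The divisor \<open>(exp t)\<^sup>2\<close> is the factor \<open>y\<^sup>2\<close> that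
  the Jacobian cancels, leaving a function of the form value alone.\<close>

lemma poincare_density_exp:
  "poincare_density \<theta> (u * exp t, exp t) = poincare_const (det \<theta>) *
     exp (- hyp_form (\<theta>$1$1) (\<theta>$1$2) (\<theta>$2$2) u t) / (exp t)\<^sup>2"
proof -
  define e where "e = exp t"
  have "e > 0" by (simp add: e_def)
  then have "(\<theta>$1$1 * ((u * e)\<^sup>2 + e\<^sup>2) + 2 * \<theta>$1$2 * (u * e) + \<theta>$2$2) / e =
      hyp_form (\<theta>$1$1) (\<theta>$1$2) (\<theta>$2$2) u t"
    unfolding hyp_form_def exp_minus e_def[symmetric] by (simp add: field_simps power2_eq_square)
  then show ?thesis
    by (simp add: poincare_density_def poincare_const_def e_def[symmetric])
qed

text \<open>The factor \<open>k\<close> covers both parts of the extended integral: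
  \<open>k = 1\<close> gives the positive part and \<open>k = - 1\<close> the negative part.\<close>

lemma nn_integral_divergence:
  assumes "convex_on {0<..} f" "\<theta> \<in> Sym_pos" "\<theta>' \<in> Sym_pos"
  defines "h \<equiv> (\<lambda>z. poincare_density \<theta> z * f (poincare_density \<theta>' z / poincare_density \<theta> z))"
  shows "(\<integral>\<^sup>+z. ennreal (k * h z) \<partial>restrict_space lborel upper_half_plane) =
    hyp_integral (\<lambda>p. ennreal (k * divergence_integrand f (det \<theta>) (det \<theta>') p))
      (\<theta>$1$1) (\<theta>$1$2) (\<theta>$2$2) (\<theta>'$1$1) (\<theta>'$1$2) (\<theta>'$2$2)"
proof -
  let ?C = "poincare_const (det \<theta>)" and ?C' = "poincare_const (det \<theta>')"
  have C: "0 < ?C" "0 < ?C'"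
    using Sym_pos_entries[OF assms(2)] Sym_pos_entries[OF assms(3)] by (simp_all add: poincare_const_pos)
  define g where "g = (\<lambda>x. indicator {0<..} x * f x)"
  have g [measurable]: "g \<in> borel_measurable borel"
    unfolding g_def by (rule measurable_convex_on_positive_reals[OF assms(1)])
  have [measurable]: "poincare_density \<theta> \<in> borel_measurable borel" for \<theta>
    unfolding poincare_density_def case_prod_beta borel_prod[symmetric] by measurable
  have pos: "0 < poincare_density \<theta> z" "0 < poincare_density \<theta>' z" if "z \<in> upper_half_plane" for z
    using that C by (auto simp: upper_half_plane_def poincare_density_def poincare_const_def[symmetric])
  \<comment> \<open>Both densities are positive on the half-plane, so \<open>f\<close> may be
    replaced by its Borel truncation \<open>g\<close>.\<close>
  have "(\<integral>\<^sup>+z. ennreal (k * h z) \<partial>restrict_space lborel upper_half_plane) =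
      (\<integral>\<^sup>+z. ennreal (k * (poincare_density \<theta> z * g (poincare_density \<theta>' z / poincare_density \<theta> z)))
        \<partial>restrict_space lborel upper_half_plane)"
    using pos by (intro nn_integral_cong) (auto simp: h_def g_def space_restrict_space)
  also have "\<dots> = (\<integral>\<^sup>+t. \<integral>\<^sup>+u. ennreal ((exp t)\<^sup>2) * ennreal (k * (poincare_density \<theta> (u * exp t, exp t) *
      g (poincare_density \<theta>' (u * exp t, exp t) / poincare_density \<theta> (u * exp t, exp t)))) \<partial>lborel \<partial>lborel)"
    by (rule nn_integral_upper_half_plane) measurable
  also have "\<dots> = hyp_integral (\<lambda>p. ennreal (k * divergence_integrand f (det \<theta>) (det \<theta>') p))
      (\<theta>$1$1) (\<theta>$1$2) (\<theta>$2$2) (\<theta>'$1$1) (\<theta>'$1$2) (\<theta>'$2$2)"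
    unfolding hyp_integral_def
  proof (intro nn_integral_cong)
    fix t u :: real
    let ?v = "hyp_form (\<theta>$1$1) (\<theta>$1$2) (\<theta>$2$2) u t" and ?w = "hyp_form (\<theta>'$1$1) (\<theta>'$1$2) (\<theta>'$2$2) u t"
    have quot: "poincare_density \<theta>' (u * exp t, exp t) / poincare_density \<theta> (u * exp t, exp t) =
        ?C' / ?C * exp (?v - ?w)"
      unfolding poincare_density_exp using C by (simp add: exp_diff exp_minus field_simps)
    have "(exp t)\<^sup>2 * (k * (poincare_density \<theta> (u * exp t, exp t) * g (?C' / ?C * exp (?v - ?w)))) =
        k * divergence_integrand f (det \<theta>) (det \<theta>') (?v, ?w)"
      unfolding poincare_density_exp divergence_integrand_def g_def by (simp add: Let_def)
    then show "ennreal ((exp t)\<^sup>2) * ennreal (k * (poincare_density \<theta> (u * exp t, exp t) *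
        g (poincare_density \<theta>' (u * exp t, exp t) / poincare_density \<theta> (u * exp t, exp t)))) =
        ennreal (k * divergence_integrand f (det \<theta>) (det \<theta>') (?v, ?w))"
      unfolding quot by (simp only: ennreal_mult'[symmetric] zero_le_power2)
  qed
  finally show ?thesis .
qed

section \<open>Matrix inverses and the trace as a mixed discriminant\<close>

lemma matrix_inv_right_left:
  fixes A :: "real^'n^'n"
  assumes "det A \<noteq> 0"
  shows "A ** matrix_inv A = mat 1" "matrix_inv A ** A = mat 1"
proof -
  have "\<exists>B. A ** B = mat 1 \<and> B ** A = mat 1"
    using assms invertible_det_nz invertible_def by metis
  then have "A ** matrix_inv A = mat 1 \<and> matrix_inv A ** A = mat 1"
    unfolding matrix_inv_def by (rule someI_ex)
  then show "A ** matrix_inv A = mat 1" "matrix_inv A ** A = mat 1" by auto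
qed

lemma matrix_inv_eqI:
  fixes A B :: "real^'n^'n"
  assumes "A ** B = mat 1"
  shows "matrix_inv A = B"
proof -
  have "det A * det B = 1" using assms by (metis det_I det_mul)
  then have "matrix_inv A ** A = mat 1" by (intro matrix_inv_right_left) auto
  then show ?thesis by (metis assms matrix_mul_assoc matrix_mul_lid matrix_mul_rid)
qed

text \<open>The inverse is the adjugate divided by the determinant. This turns the trace of the
  triplet into the mixed discriminant that \<open>hyp_integral_eqI\<close> compares.\<close>

lemma det_times_trace_matrix_inv:
  assumes "\<theta> \<in> Sym_pos" "\<theta>' \<in> Sym_pos"
  shows "det \<theta> * trace (\<theta>' ** matrix_inv \<theta>) =
    \<theta>$1$1 * \<theta>'$2$2 + \<theta>'$1$1 * \<theta>$2$2 - 2 * \<theta>$1$2 * \<theta>'$1$2"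
proof -
  note e = Sym_pos_entries[OF assms(1)]
  define d where "d = det \<theta>"
  have d: "d = \<theta>$1$1 * \<theta>$2$2 - \<theta>$1$2 * \<theta>$1$2" "d \<noteq> 0" using e by (auto simp: d_def power2_eq_square)
  define B :: "real^2^2" where
    "B = vector [vector [\<theta>$2$2 / d, - \<theta>$1$2 / d], vector [- \<theta>$1$2 / d, \<theta>$1$1 / d]]"
  have "\<theta> ** B = mat 1"
    using d(2) by (simp add: B_def vec_eq_iff forall_2 matrix_matrix_mult_def sum_2 e(1) mat_def
        field_simps) (simp add: d(1))
  then have "matrix_inv \<theta> = B" by (rule matrix_inv_eqI)
  then show ?thesis
    using d(2) Sym_pos_entries(1)[OF assms(2)] unfolding d_def[symmetric]
    by (simp add: B_def trace_def matrix_matrix_mult_def sum_2 field_simps)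
qed

text \<open>Both claims of the theorem reduce to this. The positive and negative parts are compared
  separately as nonnegative integrals, so infinite values need no special treatment.\<close>

lemma f_divergence_poincare_cong:
  assumes "convex_on {0<..} f"
    and "\<theta> \<in> Sym_pos" "\<theta>' \<in> Sym_pos" "\<eta> \<in> Sym_pos" "\<eta>' \<in> Sym_pos"
    and "det \<eta> = det \<theta>" "det \<eta>' = det \<theta>'"
    and "trace (\<eta>' ** matrix_inv \<eta>) = trace (\<theta>' ** matrix_inv \<theta>)"
  shows "f_divergence f (poincare_density \<theta>) (poincare_density \<theta>') =
    f_divergence f (poincare_density \<eta>) (poincare_density \<eta>')"
proof -
  let ?h = "\<lambda>\<theta> \<theta>' z. poincare_density \<theta> z * f (poincare_density \<theta>' z / poincare_density \<theta> z)"
  let ?H = "restrict_space lborel upper_half_plane"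
  have mixed: "\<eta>$1$1 * \<eta>'$2$2 + \<eta>'$1$1 * \<eta>$2$2 - 2 * \<eta>$1$2 * \<eta>'$1$2 =
      \<theta>$1$1 * \<theta>'$2$2 + \<theta>'$1$1 * \<theta>$2$2 - 2 * \<theta>$1$2 * \<theta>'$1$2"
    using assms det_times_trace_matrix_inv by metis
  have eq: "(\<integral>\<^sup>+z. ennreal (k * ?h \<theta> \<theta>' z) \<partial>?H) = (\<integral>\<^sup>+z. ennreal (k * ?h \<eta> \<eta>' z) \<partial>?H)" for k
  proof -
    note [measurable] = measurable_divergence_integrand[OF assms(1)]
    have "(\<lambda>p. ennreal (k * divergence_integrand f (det \<theta>) (det \<theta>') p)) \<in> borel_measurable (borel \<Otimes>\<^sub>M borel)"
      by measurable
    then show ?thesis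
      unfolding nn_integral_divergence[OF assms(1-3)] nn_integral_divergence[OF assms(1,4,5)] assms(6,7)
      using Sym_pos_entries[OF assms(2)] Sym_pos_entries[OF assms(3)] Sym_pos_entries[OF assms(4)]
        Sym_pos_entries[OF assms(5)] assms(6,7) mixed
      by (intro hyp_integral_eqI) simp_all
  qed
  show ?thesis
    using eq[of 1] eq[of "- 1"] unfolding f_divergence_def ext_integral_def by simp
qed

section \<open>The action of the special linear group\<close>

text \<open>The transformed quadratic form at \<open>v\<close> is the original one at
  \<open>matrix_inv g *v v\<close>, which is nonzero when \<open>v\<close> is.\<close>

lemma SL2_action_Sym_pos:
  assumes "g \<in> SL2" "\<theta> \<in> Sym_pos"
  shows "SL2_action g \<theta> \<in> Sym_pos"
proof -
  let ?k = "matrix_inv g"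
  have "g ** ?k = mat 1" using assms(1) by (simp add: SL2_def matrix_inv_right_left)
  then have inj: "?k *v v \<noteq> 0" if "v \<noteq> 0" for v
    using that by (metis matrix_vector_mul_assoc matrix_vector_mul_lid matrix_vector_mult_0_right)
  have "v \<bullet> (transpose ?k *v w) = (?k *v v) \<bullet> w" for v w
    by (metis dot_lmul_matrix inner_commute transpose_matrix_vector)
  then have "v \<bullet> (SL2_action g \<theta> *v v) = (?k *v v) \<bullet> (\<theta> *v (?k *v v))" for v
    unfolding SL2_action_def matrix_vector_mul_assoc[symmetric] by simp
  moreover have "transpose (SL2_action g \<theta>) = SL2_action g \<theta>"
    using assms(2) by (simp add: SL2_action_def Sym_pos_def matrix_transpose_mul matrix_mul_assoc)
  ultimately show ?thesis using assms(2) inj by (simp add: Sym_pos_def)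
qed

lemma det_SL2_action:
  assumes "g \<in> SL2"
  shows "det (SL2_action g \<theta>) = det \<theta>"
proof -
  have "det g * det (matrix_inv g) = 1"
    using assms unfolding det_mul[symmetric] by (simp add: SL2_def matrix_inv_right_left)
  then show ?thesis using assms by (simp add: SL2_action_def det_mul SL2_def)
qed

text \<open>The inverse of \<open>SL2_action g \<theta>\<close> is
  \<open>g ** matrix_inv \<theta> ** transpose g\<close>, so the product is a conjugate of
  \<open>\<theta>' ** matrix_inv \<theta>\<close> and cyclicity of the trace applies.\<close>

lemma trace_SL2_action:
  assumes "g \<in> SL2" "det \<theta> \<noteq> 0"
  shows "trace (SL2_action g \<theta>' ** matrix_inv (SL2_action g \<theta>)) = trace (\<theta>' ** matrix_inv \<theta>)"
proof -
  let ?k = "matrix_inv g" and ?i = "matrix_inv \<theta>"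
  have g: "g ** ?k = mat 1" "?k ** g = mat 1"
    using assms(1) by (simp_all add: SL2_def matrix_inv_right_left)
  have t: "transpose ?k ** transpose g = mat 1" "transpose g ** transpose ?k = mat 1"
    using g by (simp_all flip: matrix_transpose_mul)
  have cancel: "X ** ?k ** g = X" "X ** \<theta> ** ?i = X" "X ** transpose g ** transpose ?k = X"
    for X :: "real^2^2"
    using g t matrix_inv_right_left[OF assms(2)] by (simp_all flip: matrix_mul_assoc)
  have "SL2_action g \<theta> ** (g ** ?i ** transpose g) = mat 1"
    by (simp add: SL2_action_def matrix_mul_assoc cancel t)
  then have inv: "matrix_inv (SL2_action g \<theta>) = g ** ?i ** transpose g" by (rule matrix_inv_eqI)
  have "SL2_action g \<theta>' ** matrix_inv (SL2_action g \<theta>) = transpose ?k ** (\<theta>' ** ?i ** transpose g)"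
    unfolding inv by (simp add: SL2_action_def matrix_mul_assoc cancel)
  then show ?thesis by (simp add: trace_mul_sym[of "transpose ?k"] cancel)
qed

theorem theorem1:
  fixes f :: "real \<Rightarrow> real"
  assumes "convex_on {0<..} f" and "f 1 = 0"
  shows "(\<exists>\<Phi> :: real \<Rightarrow> real \<Rightarrow> real \<Rightarrow> ereal.
            \<forall>\<theta>\<in>Sym_pos. \<forall>\<theta>'\<in>Sym_pos.
              f_divergence f (poincare_density \<theta>) (poincare_density \<theta>')
                = \<Phi> (det \<theta>) (det \<theta>') (trace (\<theta>' ** matrix_inv \<theta>)))
       \<and> (\<forall>g\<in>SL2. \<forall>\<theta>\<in>Sym_pos. \<forall>\<theta>'\<in>Sym_pos.
              f_divergence f (poincare_density (SL2_action g \<theta>)) (poincare_density (SL2_action g \<theta>'))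
                = f_divergence f (poincare_density \<theta>) (poincare_density \<theta>'))"
proof
  define P where "P d d' m p \<longleftrightarrow> fst p \<in> Sym_pos \<and> snd p \<in> Sym_pos \<and> det (fst p) = d \<and>
    det (snd p) = d' \<and> trace (snd p ** matrix_inv (fst p)) = m" for d d' m p
  \<comment> \<open>The value at a triplet is the divergence of some chosen pair realizing it; the
    congruence lemma makes the choice immaterial. At triplets that no pair realizes, the value is
    arbitrary.\<close>
  let ?\<Phi> = "\<lambda>d d' m. let p = SOME p. P d d' m p in
    f_divergence f (poincare_density (fst p)) (poincare_density (snd p))"
  have "f_divergence f (poincare_density \<theta>) (poincare_density \<theta>') =
      ?\<Phi> (det \<theta>) (det \<theta>') (trace (\<theta>' ** matrix_inv \<theta>))" if "\<theta> \<in> Sym_pos" "\<theta>' \<in> Sym_pos" for \<theta> \<theta>'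
  proof -
    let ?P = "P (det \<theta>) (det \<theta>') (trace (\<theta>' ** matrix_inv \<theta>))"
    have "?P (\<theta>, \<theta>')" using that by (simp add: P_def)
    then have "?P (Eps ?P)" by (rule someI)
    then show ?thesis
      unfolding P_def Let_def by (intro f_divergence_poincare_cong assms that) auto
  qed
  then show "\<exists>\<Phi>. \<forall>\<theta>\<in>Sym_pos. \<forall>\<theta>'\<in>Sym_pos.
      f_divergence f (poincare_density \<theta>) (poincare_density \<theta>')
        = \<Phi> (det \<theta>) (det \<theta>') (trace (\<theta>' ** matrix_inv \<theta>))"
    by (intro exI[of _ ?\<Phi>]) blast
  show "\<forall>g\<in>SL2. \<forall>\<theta>\<in>Sym_pos. \<forall>\<theta>'\<in>Sym_pos.
      f_divergence f (poincare_density (SL2_action g \<theta>)) (poincare_density (SL2_action g \<theta>'))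
        = f_divergence f (poincare_density \<theta>) (poincare_density \<theta>')"
  proof (intro ballI f_divergence_poincare_cong assms)
    fix g \<theta> \<theta>'
    assume "g \<in> SL2" "\<theta> \<in> Sym_pos" "\<theta>' \<in> Sym_pos"
    moreover from this have "det \<theta> \<noteq> 0" using Sym_pos_entries by fastforce
    ultimately show "SL2_action g \<theta> \<in> Sym_pos" "SL2_action g \<theta>' \<in> Sym_pos"
      "\<theta> \<in> Sym_pos" "\<theta>' \<in> Sym_pos"
      "det \<theta> = det (SL2_action g \<theta>)" "det \<theta>' = det (SL2_action g \<theta>')"
      "trace (\<theta>' ** matrix_inv \<theta>) = trace (SL2_action g \<theta>' ** matrix_inv (SL2_action g \<theta>))"
      by (simp_all add: SL2_action_Sym_pos det_SL2_action trace_SL2_action)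
  qed
qed

end
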